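(* Let $1<M<\infty$ and let $(Y_n)_{n\ge0}$ be a time-homogeneous Markov chain on $\mathcal S=\{1,\dots,M\}$ with transition matrix $P=(P_{ij})$, $P_{ij}=\mathbb P(Y_1=j\mid Y_0=i)$, such that $P_{ij}>0$ for all $i,j\in\mathcal S$. Let $\theta:\mathcal S\to\mathbb R$, let $\widetilde P=(\widetilde P_{ij})_{i,j\in\mathcal S}$ with $\widetilde P_{ij}=e^{\theta(i)}P_{ij}$, and let $\lambda_1=\max\{\mathrm{Re}(\lambda):\lambda\in\mathrm{Spec}(\widetilde P)\}$. Then there exist two positive constants $K_3,K_4$ such that, for every initial probability distribution $\mu$ of $(Y_n)_{n\ge0}$, $$K_3\lambda_1^n\le\mathbb E_\mu\Big[\exp\Big\{\sum_{k=0}^{n-1}\theta(Y_k)\Big\}\Big]\le K_4\lambda_1^n$$ for $n$ large enough.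
   Context: $\mathrm{Spec}(\widetilde P)$ is the set of (complex) eigenvalues of the matrix $\widetilde P$; $\mathbb E_\mu$ is expectation when $Y_0$ has law $\mu$. The constants $K_3,K_4$ do not depend on $\mu$. *)

theory Defs
  imports "HOL-Probability.Probability" "Jordan_Normal_Form.Spectral_Radius"
begin

definition stochastic_on :: "nat set \<Rightarrow> (nat \<Rightarrow> nat \<Rightarrow> real) \<Rightarrow> bool" where
  "stochastic_on S P \<longleftrightarrow>
     (\<forall>i\<in>S. (\<forall>j\<in>S. 0 \<le> P i j) \<and> (\<Sum>j\<in>S. P i j) = 1)"

text \<open>The Markov property is stated in its elementary discrete form, and only for
  histories of positive probability: \<open>cond_prob\<close> returns the junk value 0 when the
  conditioning event is null. Time-homogeneity is the fact that \<open>P\<close> does not depend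
  on the time \<open>n\<close>.\<close>

definition markov_chain ::
  "nat set \<Rightarrow> (nat \<Rightarrow> nat \<Rightarrow> real) \<Rightarrow> nat pmf \<Rightarrow> 'a measure \<Rightarrow> (nat \<Rightarrow> 'a \<Rightarrow> nat) \<Rightarrow> bool" where
  "markov_chain S P \<mu> \<Omega> Y \<longleftrightarrow>
     prob_space \<Omega> \<and>
     (\<forall>n. Y n \<in> measurable \<Omega> (count_space S)) \<and>
     distr \<Omega> (count_space UNIV) (Y 0) = measure_pmf \<mu> \<and>
     (\<forall>n x j. (\<forall>k\<le>n. x k \<in> S) \<longrightarrow> j \<in> S \<longrightarrow>
        \<P>(\<omega> in \<Omega>. \<forall>k\<le>n. Y k \<omega> = x k) > 0 \<longrightarrow>
        \<P>(\<omega> in \<Omega>. Y (Suc n) \<omega> = j \<bar> \<forall>k\<le>n. Y k \<omega> = x k) = P (x n) j)"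

text \<open>Library matrices are indexed from 0, the state space is \<open>{1..M}\<close>; hence the shift.
  The entries are complex so that \<open>spectrum\<close> consists of all complex eigenvalues.\<close>

definition tilted_matrix ::
  "nat \<Rightarrow> (nat \<Rightarrow> real) \<Rightarrow> (nat \<Rightarrow> nat \<Rightarrow> real) \<Rightarrow> complex mat" where
  "tilted_matrix M \<theta> P =
     mat M M (\<lambda>(i, j). complex_of_real (exp (\<theta> (Suc i)) * P (Suc i) (Suc j)))"

end

theory Submission
  imports Defs
begin

text \<open>The tilted matrix has a positive eigenvector \<open>v\<close> whose eigenvalue is its spectral radius,
  and that radius is therefore also the largest real part \<open>\<lambda>\<^sub>1\<close> in the spectrum. The eigenvector
  equation makes \<open>\<lambda>\<^sub>1\<^sup>-\<^sup>n exp (\<Sum>k<n. \<theta> (Y k)) v (Y n)\<close> have constant expectation in \<open>n\<close>; as \<open>v\<close> lies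
  between two positive constants, \<open>K\<^sub>3 = min v / max v\<close> and \<open>K\<^sub>4 = max v / min v\<close> work, for
  every \<open>n\<close> and every initial law.\<close>

section \<open>Perron-Frobenius theory for positive matrices\<close>

lemma eigenvector_iff_sum:
  fixes A :: "'a::comm_ring_1 mat"
  assumes A: "A \<in> carrier_mat n n"
  shows "eigenvector A v k \<longleftrightarrow>
    v \<in> carrier_vec n \<and> v \<noteq> 0\<^sub>v n \<and> (\<forall>i<n. (\<Sum>j<n. A $$ (i,j) * v $ j) = k * v $ i)"
proof -
  have "A *\<^sub>v v = k \<cdot>\<^sub>v v \<longleftrightarrow> (\<forall>i<n. (\<Sum>j<n. A $$ (i,j) * v $ j) = k * v $ i)"
    if v: "v \<in> carrier_vec n"
    using A v by (auto simp: vec_eq_iff scalar_prod_def atLeast0LessThan)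
  then show ?thesis
    using A by (auto simp: eigenvector_def)
qed

text \<open>A nonnegative matrix preserves componentwise inequalities, so the subinvariance of
  \<open>y\<close> can be iterated. Nonnegativity of the entries of the powers is carried along in
  the induction, because \<open>sub\<close> is applied under a sum weighted by them. The real parts
  appear because \<open>spectral_radius\<close> is used for complex matrices.\<close>

lemma power_mat_subinvariant:
  fixes n :: nat and B :: "complex mat" and b :: "nat \<Rightarrow> nat \<Rightarrow> real" and y :: "nat \<Rightarrow> real"
  defines "B \<equiv> mat n n (\<lambda>(i, j). complex_of_real (b i j))"
  assumes b: "\<And>i j. i < n \<Longrightarrow> j < n \<Longrightarrow> 0 \<le> b i j"
    and t: "0 \<le> t"
    and sub: "\<And>i. i < n \<Longrightarrow> t * y i \<le> (\<Sum>j<n. b i j * y j)"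
    and i: "i < n"
  shows "(\<forall>j<n. 0 \<le> Re ((B ^\<^sub>m k) $$ (i,j))) \<and>
    t ^ k * y i \<le> (\<Sum>j<n. Re ((B ^\<^sub>m k) $$ (i,j)) * y j)"
proof (induction k)
  case 0
  have "(\<Sum>j<n. Re ((1\<^sub>m n) $$ (i,j)) * y j) = (\<Sum>j<n. if j = i then y j else 0)"
    by (rule sum.cong) (use i in auto)
  then show ?case
    using i by (auto simp: B_def)
next
  case (Suc k)
  define p where "p j = Re ((B ^\<^sub>m k) $$ (i,j))" for j
  have B: "B \<in> carrier_mat n n"
    by (simp add: B_def)
  then have Bk: "B ^\<^sub>m k \<in> carrier_mat n n"
    by simp
  \<comment> \<open>\<open>B ^\<^sub>m Suc k\<close> is \<open>B ^\<^sub>m k * B\<close>: the new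
    factor stands on the right, next to \<open>y\<close>, where \<open>sub\<close> applies.\<close>
  have entry: "Re ((B ^\<^sub>m Suc k) $$ (i,j)) = (\<Sum>l<n. p l * b l j)" if "j < n" for j
    using i that B Bk
    by (simp add: scalar_prod_def atLeast0LessThan p_def) (simp add: B_def)
  have p: "0 \<le> p j" if "j < n" for j
    using Suc that by (simp add: p_def)
  have entry_nonneg: "\<forall>j<n. 0 \<le> Re ((B ^\<^sub>m Suc k) $$ (i,j))"
  proof (intro allI impI)
    fix j assume j: "j < n"
    show "0 \<le> Re ((B ^\<^sub>m Suc k) $$ (i,j))"
      unfolding entry[OF j] by (intro sum_nonneg mult_nonneg_nonneg p b j) auto
  qed
  have "t ^ Suc k * y i = t * (t ^ k * y i)"
    by simp
  also have "\<dots> \<le> t * (\<Sum>l<n. p l * y l)"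
    using Suc t by (intro mult_left_mono) (auto simp: p_def)
  also have "\<dots> = (\<Sum>l<n. p l * (t * y l))"
    by (simp add: sum_distrib_left mult_ac)
  also have "\<dots> \<le> (\<Sum>l<n. p l * (\<Sum>j<n. b l j * y j))"
    using p sub by (intro sum_mono mult_left_mono) auto
  also have "\<dots> = (\<Sum>l<n. \<Sum>j<n. p l * b l j * y j)"
    by (simp add: sum_distrib_left mult_ac)
  also have "\<dots> = (\<Sum>j<n. \<Sum>l<n. p l * b l j * y j)"
    by (rule sum.swap)
  also have "\<dots> = (\<Sum>j<n. Re ((B ^\<^sub>m Suc k) $$ (i,j)) * y j)"
    by (intro sum.cong) (simp_all only: lessThan_iff entry sum_distrib_right)
  finally have "t ^ Suc k * y i \<le> (\<Sum>j<n. Re ((B ^\<^sub>m Suc k) $$ (i,j)) * y j)" .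
  with entry_nonneg show ?case ..
qed

text \<open>After rescaling the matrix to spectral radius below 1 its powers are bounded, whereas
  a subinvariance factor above 1 would make them grow.\<close>

lemma subinvariant_le_spectral_radius:
  fixes n :: nat and a :: "nat \<Rightarrow> nat \<Rightarrow> real" and y :: "nat \<Rightarrow> real"
  defines "A \<equiv> mat n n (\<lambda>(i, j). complex_of_real (a i j))"
  assumes n: "0 < n"
    and a: "\<And>i j. i < n \<Longrightarrow> j < n \<Longrightarrow> 0 \<le> a i j"
    and y: "\<And>i. i < n \<Longrightarrow> 0 < y i"
    and sub: "\<And>i. i < n \<Longrightarrow> t * y i \<le> (\<Sum>j<n. a i j * y j)"
  shows "t \<le> spectral_radius A"
proof (rule ccontr)
  assume "\<not> t \<le> spectral_radius A"
  then have lt: "spectral_radius A < t"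
    by simp
  have A: "A \<in> carrier_mat n n"
    by (simp add: A_def)
  have "0 \<le> spectral_radius A"
    using spectral_radius_mem_max(1)[OF A n] by auto
  \<comment> \<open>The midpoint leaves room on both sides: dividing by \<open>s\<close> gives
    spectral radius below 1, while \<open>t / s\<close> stays above 1. It is positive even if the
    spectral radius is 0.\<close>
  define s where "s = (spectral_radius A + t) / 2"
  have s: "0 < s" "spectral_radius A < s" "s < t"
    using lt \<open>0 \<le> spectral_radius A\<close> by (auto simp: s_def)
  define B where "B = mat n n (\<lambda>(i, j). complex_of_real (a i j / s))"
  have B: "B \<in> carrier_mat n n"
    by (simp add: B_def)
  obtain ev where ev: "ev \<in> spectrum B" "spectral_radius B = norm ev"
    using spectral_radius_mem_max(1)[OF B n] by auto
  then obtain v where v: "eigenvector B v ev"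
    by (auto simp: spectrum_def eigenvalue_def)
  \<comment> \<open>A dominant eigenvalue of \<open>B\<close>, scaled back by \<open>s\<close>, is
    an eigenvalue of \<open>A\<close>; this bounds the spectral radius of \<open>B\<close> from
    above.\<close>
  have "eigenvector A v (of_real s * ev)"
    unfolding eigenvector_iff_sum[OF A]
  proof (intro conjI allI impI)
    show "v \<in> carrier_vec n" "v \<noteq> 0\<^sub>v n"
      using v unfolding eigenvector_iff_sum[OF B] by auto
    fix i assume i: "i < n"
    have "(\<Sum>j<n. A $$ (i,j) * v $ j) = of_real s * (\<Sum>j<n. B $$ (i,j) * v $ j)"
      using i s unfolding sum_distrib_left by (intro sum.cong) (auto simp: A_def B_def)
    then show "(\<Sum>j<n. A $$ (i,j) * v $ j) = of_real s * ev * v $ i"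
      using v i unfolding eigenvector_iff_sum[OF B] by simp
  qed
  then have "of_real s * ev \<in> spectrum A"
    by (auto simp: spectrum_def eigenvalue_def)
  then have "norm (of_real s * ev) \<le> spectral_radius A"
    by (intro spectral_radius_mem_max(2)[OF A n] imageI)
  then have "s * norm ev \<le> spectral_radius A"
    using s(1) by (simp add: norm_mult)
  then have "s * norm ev < s * 1"
    using s by linarith
  then have "spectral_radius B < 1"
    using s(1) ev(2) by simp
  then obtain c where c: "\<And>k. norm_bound (B ^\<^sub>m k) c"
    using spectral_radius_jnf_norm_bound_less_1_upper_triangular[OF B] by blast
  \<comment> \<open>The constant \<open>c\<close> bounds all entries of all powers at once. Row 0
    stands for an arbitrary row.\<close>
  have bnd: "(t / s) ^ k * y 0 \<le> c * (\<Sum>j<n. y j)" for k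
  proof -
    have "(t / s) ^ k * y 0 \<le> (\<Sum>j<n. Re ((B ^\<^sub>m k) $$ (0,j)) * y j)"
      unfolding B_def
    proof (rule power_mat_subinvariant[THEN conjunct2])
      show "t / s * y i \<le> (\<Sum>j<n. a i j / s * y j)" if "i < n" for i
        using divide_right_mono[OF sub[OF that], of s] s(1) by (simp add: sum_divide_distrib)
    qed (use a s n in auto)
    also have "\<dots> \<le> (\<Sum>j<n. c * y j)"
    proof (intro sum_mono mult_right_mono)
      fix j assume "j \<in> {..<n}"
      then show "0 \<le> y j"
        using y by (simp add: less_imp_le)
      have "norm ((B ^\<^sub>m k) $$ (0,j)) \<le> c"
        using c[of k] B n \<open>j \<in> {..<n}\<close> by (auto simp: norm_bound_def)
      then show "Re ((B ^\<^sub>m k) $$ (0,j)) \<le> c"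
        using complex_Re_le_cmod order_trans by blast
    qed
    finally show ?thesis
      by (simp add: sum_distrib_left)
  qed
  obtain k where "c * (\<Sum>j<n. y j) / y 0 < (t / s) ^ k"
    using real_arch_pow[of "t / s"] s by auto
  then have "c * (\<Sum>j<n. y j) < (t / s) ^ k * y 0"
    using y[OF n] by (simp add: pos_divide_less_eq)
  with bnd[of k] show False
    by simp
qed

text \<open>For an eigenvalue of maximal modulus with eigenvector \<open>x\<close>, the vector \<open>\<bar>x\<bar>\<close> is
  subinvariant. If it were not invariant, its image would be strictly subinvariant, with a
  factor exceeding the spectral radius.\<close>

lemma perron_eigenvector:
  fixes n :: nat and a :: "nat \<Rightarrow> nat \<Rightarrow> real"
  defines "A \<equiv> mat n n (\<lambda>(i, j). complex_of_real (a i j))"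
  assumes n: "0 < n"
    and a: "\<And>i j. i < n \<Longrightarrow> j < n \<Longrightarrow> 0 < a i j"
  obtains w where "\<And>i. i < n \<Longrightarrow> 0 < w i"
    and "\<And>i. i < n \<Longrightarrow> (\<Sum>j<n. a i j * w j) = spectral_radius A * w i"
    and "0 < spectral_radius A"
proof -
  define r where "r = spectral_radius A"
  have A: "A \<in> carrier_mat n n"
    by (simp add: A_def)
  obtain ev where ev: "ev \<in> spectrum A" "r = norm ev"
    using spectral_radius_mem_max(1)[OF A n] by (auto simp: r_def)
  then obtain x where x: "eigenvector A x ev"
    by (auto simp: spectrum_def eigenvalue_def)
  define w where "w i = norm (x $ i)" for i
  define y where "y i = (\<Sum>j<n. a i j * w j)" for i
  have r0: "0 \<le> r"
    using ev by simp
  have w_nonneg: "0 \<le> w i" for i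
    by (simp add: w_def)
  have "\<exists>i<n. x $ i \<noteq> 0"
    using x unfolding eigenvector_iff_sum[OF A] by (auto simp: vec_eq_iff)
  then obtain l where l: "l < n" "0 < w l"
    by (auto simp: w_def)
  \<comment> \<open>A single nonzero component of the eigenvector suffices, since every entry of the
    matrix is positive.\<close>
  have y_pos: "0 < y i" if "i < n" for i
    unfolding y_def
    by (rule sum_pos2[of _ l]) (use l a[OF that] w_nonneg in \<open>auto simp: less_imp_le\<close>)
  have sub: "r * w i \<le> y i" if i: "i < n" for i
  proof -
    have "r * w i = norm (\<Sum>j<n. A $$ (i,j) * x $ j)"
      using x i unfolding eigenvector_iff_sum[OF A] by (simp add: ev w_def norm_mult)
    also have "\<dots> \<le> (\<Sum>j<n. norm (A $$ (i,j) * x $ j))"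
      by (rule norm_sum)
    also have "\<dots> = y i"
      unfolding y_def
      by (rule sum.cong) (use i a in \<open>auto simp: A_def w_def norm_mult less_imp_le\<close>)
    finally show ?thesis .
  qed
  have eq: "y i = r * w i" if i: "i < n" for i
  proof (rule ccontr)
    assume "y i \<noteq> r * w i"
    with sub[OF i] have strict_i: "r * w i < y i"
      by simp
    \<comment> \<open>The vector \<open>y - r w\<close> is nonnegative and positive at
      \<open>i\<close>; the positive matrix turns it into a vector positive in every
      component.\<close>
    have strict: "r * y m < (\<Sum>j<n. a m j * y j)" if m: "m < n" for m
    proof -
      have "r * y m = (\<Sum>j<n. a m j * (r * w j))"
        by (simp add: y_def sum_distrib_left mult_ac)
      also have "\<dots> < (\<Sum>j<n. a m j * y j)"
        by (rule sum_strict_mono_ex1)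
          (use i m a[OF m] sub strict_i in \<open>auto intro!: mult_left_mono bexI[of _ i] simp: less_imp_le\<close>)
      finally show ?thesis .
    qed
    \<comment> \<open>The Collatz-Wielandt quotient of \<open>y\<close>: the largest factor for
      which \<open>y\<close> is subinvariant. As a minimum of finitely many numbers above
      \<open>r\<close>, it exceeds \<open>r\<close>.\<close>
    define t where "t = Min ((\<lambda>m. (\<Sum>j<n. a m j * y j) / y m) ` {..<n})"
    have "t \<in> (\<lambda>m. (\<Sum>j<n. a m j * y j) / y m) ` {..<n}"
      unfolding t_def using n by (intro Min_in) auto
    then have "r < t"
      using strict y_pos by (auto simp: pos_less_divide_eq)
    moreover have "t \<le> spectral_radius A"
      unfolding A_def
    proof (rule subinvariant_le_spectral_radius)
      fix m assume m: "m < n"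
      then have "t \<le> (\<Sum>j<n. a m j * y j) / y m"
        unfolding t_def by (intro Min_le) auto
      then show "t * y m \<le> (\<Sum>j<n. a m j * y j)"
        using y_pos[OF m] by (simp add: pos_le_divide_eq)
    qed (use n a y_pos in \<open>auto simp: less_imp_le\<close>)
    ultimately show False
      by (simp add: r_def)
  qed
  have r_pos: "0 < r"
    using y_pos[OF n] eq[OF n] r0 by (cases "r = 0") auto
  show thesis
  proof
    \<comment> \<open>Invariance upgrades \<open>w\<close> from nonnegative to positive:
      \<open>r * w i\<close> equals \<open>y i\<close>, which is positive.\<close>
    show "0 < w i" if "i < n" for i
      using y_pos[OF that] eq[OF that] r_pos by (simp add: zero_less_mult_iff)
    show "(\<Sum>j<n. a i j * w j) = spectral_radius A * w i" if "i < n" for i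
      using eq[OF that] by (simp add: y_def r_def)
    show "0 < spectral_radius A"
      using r_pos by (simp add: r_def)
  qed
qed

text \<open>Real parts are bounded by moduli, and the bound is attained because the radius is itself
  an eigenvalue.\<close>

lemma Max_Re_spectrum_eq_spectral_radius:
  assumes A: "A \<in> carrier_mat n n" and n: "0 < n"
    and "complex_of_real (spectral_radius A) \<in> spectrum A"
  shows "Max (Re ` spectrum A) = spectral_radius A"
proof (rule Max_eqI)
  show "finite (Re ` spectrum A)"
    using card_finite_spectrum(1)[OF A] by simp
  show "spectral_radius A \<in> Re ` spectrum A"
    using assms(3) by force
  fix x assume "x \<in> Re ` spectrum A"
  then obtain ev where "ev \<in> spectrum A" "x = Re ev"
    by auto
  then show "x \<le> spectral_radius A"
    using spectral_radius_mem_max(2)[OF A n, of "norm ev"] complex_Re_le_cmod[of ev] by auto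
qed

text \<open>Transfers the Perron eigenvector from matrix indices to states. Pulling out
  \<open>exp (\<theta> i)\<close> leaves the one-step average of \<open>v\<close> under
  \<open>P\<close>, the form in which the Markov property produces it.\<close>

lemma tilted_matrix_perron:
  fixes M :: nat and P :: "nat \<Rightarrow> nat \<Rightarrow> real" and \<theta> :: "nat \<Rightarrow> real"
  assumes "0 < M"
    and P: "\<And>i j. i \<in> {1..M} \<Longrightarrow> j \<in> {1..M} \<Longrightarrow> 0 < P i j"
  defines "r \<equiv> Max (Re ` spectrum (tilted_matrix M \<theta> P))"
  obtains v where "\<And>i. i \<in> {1..M} \<Longrightarrow> 0 < v i"
    and "\<And>i. i \<in> {1..M} \<Longrightarrow> exp (\<theta> i) * (\<Sum>j\<in>{1..M}. P i j * v j) = r * v i"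
    and "0 < r"
proof -
  define a where "a i j = exp (\<theta> (Suc i)) * P (Suc i) (Suc j)" for i j
  define A where "A = mat M M (\<lambda>(i, j). complex_of_real (a i j))"
  have tilted: "tilted_matrix M \<theta> P = A"
    by (simp add: tilted_matrix_def A_def a_def)
  have A: "A \<in> carrier_mat M M"
    by (simp add: A_def)
  have "0 < a i j" if "i < M" "j < M" for i j
    using that P by (simp add: a_def)
  then obtain w where w: "\<And>i. i < M \<Longrightarrow> 0 < w i"
    "\<And>i. i < M \<Longrightarrow> (\<Sum>j<M. a i j * w j) = spectral_radius A * w i"
    and sr: "0 < spectral_radius A"
    unfolding A_def using perron_eigenvector[OF \<open>0 < M\<close>, of a] by blast
  \<comment> \<open>The positive real eigenvector, read as a complex one, puts the spectral radius
    into the spectrum, so that it is the maximal real part.\<close>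
  have "eigenvector A (vec M (\<lambda>i. complex_of_real (w i))) (complex_of_real (spectral_radius A))"
    unfolding eigenvector_iff_sum[OF A]
  proof (intro conjI allI impI)
    show "vec M (\<lambda>i. complex_of_real (w i)) \<noteq> 0\<^sub>v M"
      using w(1)[OF \<open>0 < M\<close>] \<open>0 < M\<close> by (auto simp: vec_eq_iff)
    fix i assume i: "i < M"
    have "(\<Sum>j<M. A $$ (i, j) * vec M (\<lambda>i. complex_of_real (w i)) $ j)
        = complex_of_real (\<Sum>j<M. a i j * w j)"
      using i by (simp add: A_def)
    then show "(\<Sum>j<M. A $$ (i, j) * vec M (\<lambda>i. complex_of_real (w i)) $ j)
        = complex_of_real (spectral_radius A) * vec M (\<lambda>i. complex_of_real (w i)) $ i"
      using w(2)[OF i] i by simp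
  qed auto
  then have r: "r = spectral_radius A"
    using Max_Re_spectrum_eq_spectral_radius[OF A \<open>0 < M\<close>]
    by (auto simp: r_def tilted spectrum_def eigenvalue_def)
  show thesis
  proof
    \<comment> \<open>The witness is \<open>w\<close> shifted by one, as states start at 1 and
      matrix indices at 0.\<close>
    show "0 < w (i - 1)" if "i \<in> {1..M}" for i
      using that by (intro w(1)) auto
    show "exp (\<theta> i) * (\<Sum>j\<in>{1..M}. P i j * w (j - 1)) = r * w (i - 1)" if "i \<in> {1..M}" for i
    proof -
      obtain l where l: "i = Suc l" "l < M"
        using \<open>i \<in> {1..M}\<close> by (metis Suc_le_D Suc_le_lessD atLeastAtMost_iff One_nat_def)
      have "(\<Sum>j\<in>{1..M}. P i j * w (j - 1)) = (\<Sum>j<M. P i (Suc j) * w j)"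
        by (simp add: sum.atLeast1_atMost_eq)
      then show ?thesis
        using w(2)[OF l(2)] l r by (simp add: a_def sum_distrib_left mult_ac)
    qed
    show "0 < r"
      using r sr by simp
  qed
qed

section \<open>Expectations of functions of a finite history of the chain\<close>

text \<open>In product form the Markov property also covers null histories, where the conditional
  probability is a default value: both sides are then 0.\<close>

lemma markov_chain_path_step:
  assumes "markov_chain S P \<mu> \<Omega> Y" and x: "\<And>k. k \<le> n \<Longrightarrow> x k \<in> S" and j: "j \<in> S"
  shows "\<P>(\<omega> in \<Omega>. (\<forall>k\<le>n. Y k \<omega> = x k) \<and> Y (Suc n) \<omega> = j)
    = \<P>(\<omega> in \<Omega>. \<forall>k\<le>n. Y k \<omega> = x k) * P (x n) j"
proof -
  interpret prob_space \<Omega>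
    using assms(1) by (simp add: markov_chain_def)
  have [measurable]: "Y k \<in> measurable \<Omega> (count_space S)" for k
    using assms(1) by (simp add: markov_chain_def)
  show ?thesis
  proof (cases "\<P>(\<omega> in \<Omega>. \<forall>k\<le>n. Y k \<omega> = x k) > 0")
    case True
    then have "\<P>(\<omega> in \<Omega>. Y (Suc n) \<omega> = j \<bar> \<forall>k\<le>n. Y k \<omega> = x k) = P (x n) j"
      using assms unfolding markov_chain_def by blast
    then show ?thesis
      using True by (simp add: cond_prob_def conj_commute field_simps)
  next
    case False
    then have zero: "\<P>(\<omega> in \<Omega>. \<forall>k\<le>n. Y k \<omega> = x k) = 0"
      using measure_nonneg[of \<Omega>] by (simp add: zero_less_measure_iff)
    moreover have "\<P>(\<omega> in \<Omega>. (\<forall>k\<le>n. Y k \<omega> = x k) \<and> Y (Suc n) \<omega> = j)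
        \<le> \<P>(\<omega> in \<Omega>. \<forall>k\<le>n. Y k \<omega> = x k)"
      by (rule finite_measure_mono) auto
    ultimately show ?thesis
      using measure_nonneg[of \<Omega> "{\<omega> \<in> space \<Omega>. (\<forall>k\<le>n. Y k \<omega> = x k) \<and> Y (Suc n) \<omega> = j}"]
      by simp
  qed
qed

text \<open>With finitely many states there are finitely many histories up to time \<open>n\<close>,
  so a function of the history is a simple function and its expectation a finite sum over paths. The
  event \<open>D\<close> leaves room for a condition on the next state.\<close>

lemma expectation_history:
  fixes f :: "(nat \<Rightarrow> 'b) \<Rightarrow> real"
  assumes "prob_space \<Omega>" and "finite S"
    and [measurable]: "\<And>k. Y k \<in> measurable \<Omega> (count_space S)"
    and f: "\<And>x x'. (\<And>k. k \<le> n \<Longrightarrow> x k = x' k) \<Longrightarrow> f x = f x'"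
    and D: "D \<in> sets \<Omega>"
  shows "integrable \<Omega> (\<lambda>\<omega>. f (\<lambda>k. Y k \<omega>) * indicator D \<omega>)"
    and "prob_space.expectation \<Omega> (\<lambda>\<omega>. f (\<lambda>k. Y k \<omega>) * indicator D \<omega>) =
      (\<Sum>x\<in>{..n} \<rightarrow>\<^sub>E S. f x * \<P>(\<omega> in \<Omega>. (\<forall>k\<le>n. Y k \<omega> = x k) \<and> \<omega> \<in> D))"
proof -
  interpret prob_space \<Omega> by fact
  define H where "H x = {\<omega> \<in> space \<Omega>. (\<forall>k\<le>n. Y k \<omega> = x k) \<and> \<omega> \<in> D}" for x
  have fin: "finite ({..n} \<rightarrow>\<^sub>E S)"
    using \<open>finite S\<close> by (intro finite_PiE) auto
  have H: "H x \<in> sets \<Omega>" if "x \<in> {..n} \<rightarrow>\<^sub>E S" for x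
  proof -
    have "H x = {\<omega> \<in> space \<Omega>. \<forall>k\<in>{..n}. Y k \<omega> = x k} \<inter> D"
      by (auto simp: H_def)
    also have "\<dots> \<in> sets \<Omega>"
      using D by measurable
    finally show ?thesis .
  qed
  have eq: "f (\<lambda>k. Y k \<omega>) * indicator D \<omega> = (\<Sum>x\<in>{..n} \<rightarrow>\<^sub>E S. f x * indicator (H x) \<omega>)"
    if \<omega>: "\<omega> \<in> space \<Omega>" for \<omega>
  proof -
    \<comment> \<open>Exactly one path in the index set agrees with \<omega> up to time
      \<open>n\<close>. The restriction is needed because members of \<open>PiE\<close> are
      \<open>undefined\<close> outside \<open>{..n}\<close>.\<close>
    define z where "z = restrict (\<lambda>k. Y k \<omega>) {..n}"
    have z: "z \<in> {..n} \<rightarrow>\<^sub>E S"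
      using \<omega> measurable_space[OF assms(3)] by (auto simp: z_def)
    have "f x * indicator (H x) \<omega> = (if x = z then f z * indicator D \<omega> else 0)"
      if "x \<in> {..n} \<rightarrow>\<^sub>E S" for x
    proof -
      have "(\<forall>k\<le>n. Y k \<omega> = x k) \<longleftrightarrow> x = z"
        using PiE_arb[OF that] by (auto simp: z_def restrict_def fun_eq_iff)
      then show ?thesis
        using \<omega> by (auto simp: H_def indicator_def)
    qed
    then have "(\<Sum>x\<in>{..n} \<rightarrow>\<^sub>E S. f x * indicator (H x) \<omega>) = f z * indicator D \<omega>"
      using fin z by (simp add: sum.delta cong: sum.cong)
    also have "f z = f (\<lambda>k. Y k \<omega>)"
      by (rule f) (simp add: z_def)
    finally show ?thesis ..
  qed
  have int: "integrable \<Omega> (\<lambda>\<omega>. f x * indicator (H x) \<omega>)" if "x \<in> {..n} \<rightarrow>\<^sub>E S" for x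
    using H[OF that] by (intro integrable_mult_right integrable_real_indicator) (auto simp: emeasure_eq_measure)
  then have "integrable \<Omega> (\<lambda>\<omega>. \<Sum>x\<in>{..n} \<rightarrow>\<^sub>E S. f x * indicator (H x) \<omega>)"
    by (rule Bochner_Integration.integrable_sum)
  then show "integrable \<Omega> (\<lambda>\<omega>. f (\<lambda>k. Y k \<omega>) * indicator D \<omega>)"
    by (subst Bochner_Integration.integrable_cong[OF refl eq])
  have "expectation (\<lambda>\<omega>. f (\<lambda>k. Y k \<omega>) * indicator D \<omega>)
      = expectation (\<lambda>\<omega>. \<Sum>x\<in>{..n} \<rightarrow>\<^sub>E S. f x * indicator (H x) \<omega>)"
    by (rule Bochner_Integration.integral_cong[OF refl eq])
  also have "\<dots> = (\<Sum>x\<in>{..n} \<rightarrow>\<^sub>E S. f x * prob (H x))"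
    using int H by (subst Bochner_Integration.integral_sum) (auto intro!: sum.cong)
  finally show "expectation (\<lambda>\<omega>. f (\<lambda>k. Y k \<omega>) * indicator D \<omega>) =
      (\<Sum>x\<in>{..n} \<rightarrow>\<^sub>E S. f x * \<P>(\<omega> in \<Omega>. (\<forall>k\<le>n. Y k \<omega> = x k) \<and> \<omega> \<in> D))"
    by (simp add: H_def)
qed

lemma integrable_history:
  fixes f :: "(nat \<Rightarrow> 'b) \<Rightarrow> real"
  assumes "prob_space \<Omega>" and "finite S"
    and "\<And>k. Y k \<in> measurable \<Omega> (count_space S)"
    and "\<And>x x'. (\<And>k. k \<le> n \<Longrightarrow> x k = x' k) \<Longrightarrow> f x = f x'"
  shows "integrable \<Omega> (\<lambda>\<omega>. f (\<lambda>k. Y k \<omega>))"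
proof -
  have "integrable \<Omega> (\<lambda>\<omega>. f (\<lambda>k. Y k \<omega>) * indicator (space \<Omega>) \<omega>)"
    using assms by (rule expectation_history) auto
  then show ?thesis
    by (simp cong: Bochner_Integration.integrable_cong)
qed

text \<open>The Markov property tested against functions of the past: the next value of
  \<open>g\<close> is replaced by its average from the current state. Splitting by the next state
  and by the history reduces this to single paths.\<close>

lemma markov_chain_expectation_step:
  fixes f :: "(nat \<Rightarrow> nat) \<Rightarrow> real"
  assumes mc: "markov_chain S P \<mu> \<Omega> Y" and "finite S"
    and f: "\<And>x x'. (\<And>k. k \<le> n \<Longrightarrow> x k = x' k) \<Longrightarrow> f x = f x'"
  shows "prob_space.expectation \<Omega> (\<lambda>\<omega>. f (\<lambda>k. Y k \<omega>) * g (Y (Suc n) \<omega>))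
    = prob_space.expectation \<Omega> (\<lambda>\<omega>. f (\<lambda>k. Y k \<omega>) * (\<Sum>j\<in>S. P (Y n \<omega>) j * g j))"
proof -
  interpret prob_space \<Omega>
    using mc by (simp add: markov_chain_def)
  have Y [measurable]: "Y k \<in> measurable \<Omega> (count_space S)" for k
    using mc by (simp add: markov_chain_def)
  define D where "D j = {\<omega> \<in> space \<Omega>. Y (Suc n) \<omega> = j}" for j
  have D: "D j \<in> sets \<Omega>" if "j \<in> S" for j
    unfolding D_def by measurable
  have int: "integrable \<Omega> (\<lambda>\<omega>. f (\<lambda>k. Y k \<omega>) * indicator (D j) \<omega>)" if "j \<in> S" for j
    using prob_space_axioms \<open>finite S\<close> Y f D[OF that] by (rule expectation_history(1))
  have E: "expectation (\<lambda>\<omega>. f (\<lambda>k. Y k \<omega>) * indicator (D j) \<omega>) =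
      (\<Sum>x\<in>{..n} \<rightarrow>\<^sub>E S. f x * \<P>(\<omega> in \<Omega>. (\<forall>k\<le>n. Y k \<omega> = x k) \<and> \<omega> \<in> D j))" if "j \<in> S" for j
    using prob_space_axioms \<open>finite S\<close> Y f D[OF that] by (rule expectation_history(2))
  have path: "\<P>(\<omega> in \<Omega>. (\<forall>k\<le>n. Y k \<omega> = x k) \<and> \<omega> \<in> D j)
      = \<P>(\<omega> in \<Omega>. \<forall>k\<le>n. Y k \<omega> = x k) * P (x n) j"
    if "x \<in> {..n} \<rightarrow>\<^sub>E S" "j \<in> S" for x j
    using that markov_chain_path_step[OF mc, of n x j]
    by (auto simp: D_def PiE_iff cong: conj_cong)
  have "expectation (\<lambda>\<omega>. f (\<lambda>k. Y k \<omega>) * g (Y (Suc n) \<omega>))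
      = expectation (\<lambda>\<omega>. \<Sum>j\<in>S. g j * (f (\<lambda>k. Y k \<omega>) * indicator (D j) \<omega>))"
  proof (rule Bochner_Integration.integral_cong[OF refl])
    fix \<omega> assume \<omega>: "\<omega> \<in> space \<Omega>"
    then have "Y (Suc n) \<omega> \<in> S"
      using measurable_space[OF Y] by auto
    moreover have "(\<Sum>j\<in>S. g j * (f (\<lambda>k. Y k \<omega>) * indicator (D j) \<omega>))
        = (\<Sum>j\<in>S. if j = Y (Suc n) \<omega> then f (\<lambda>k. Y k \<omega>) * g j else 0)"
      using \<omega> by (intro sum.cong) (auto simp: D_def indicator_def)
    ultimately show "f (\<lambda>k. Y k \<omega>) * g (Y (Suc n) \<omega>)
        = (\<Sum>j\<in>S. g j * (f (\<lambda>k. Y k \<omega>) * indicator (D j) \<omega>))"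
      using \<open>finite S\<close> by simp
  qed
  also have "\<dots> = (\<Sum>j\<in>S. g j * expectation (\<lambda>\<omega>. f (\<lambda>k. Y k \<omega>) * indicator (D j) \<omega>))"
    using int by (subst Bochner_Integration.integral_sum) auto
  also have "\<dots> = (\<Sum>j\<in>S. g j * (\<Sum>x\<in>{..n} \<rightarrow>\<^sub>E S. f x *
      (\<P>(\<omega> in \<Omega>. \<forall>k\<le>n. Y k \<omega> = x k) * P (x n) j)))"
    by (simp add: E path)
  also have "\<dots> = (\<Sum>x\<in>{..n} \<rightarrow>\<^sub>E S. f x * (\<Sum>j\<in>S. P (x n) j * g j) *
      \<P>(\<omega> in \<Omega>. \<forall>k\<le>n. Y k \<omega> = x k))"
    unfolding sum_distrib_left sum_distrib_right by (subst sum.swap) (simp add: mult_ac)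
  \<comment> \<open>The trivial indicator brings the integrand into the shape of
    \<open>expectation_history\<close> with \<open>D\<close> the whole space, so the path sum can be
    folded back.\<close>
  also have "\<dots> = expectation (\<lambda>\<omega>. f (\<lambda>k. Y k \<omega>) * (\<Sum>j\<in>S. P (Y n \<omega>) j * g j)
      * indicator (space \<Omega>) \<omega>)"
  proof -
    have "f x * (\<Sum>j\<in>S. P (x n) j * g j) = f x' * (\<Sum>j\<in>S. P (x' n) j * g j)"
      if "\<And>k. k \<le> n \<Longrightarrow> x k = x' k" for x x'
      using f[OF that] that[OF order_refl] by simp
    then have "expectation (\<lambda>\<omega>. f (\<lambda>k. Y k \<omega>) * (\<Sum>j\<in>S. P (Y n \<omega>) j * g j) * indicator (space \<Omega>) \<omega>)
        = (\<Sum>x\<in>{..n} \<rightarrow>\<^sub>E S. f x * (\<Sum>j\<in>S. P (x n) j * g j) *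
          \<P>(\<omega> in \<Omega>. (\<forall>k\<le>n. Y k \<omega> = x k) \<and> \<omega> \<in> space \<Omega>))"
      by (rule expectation_history(2)[OF prob_space_axioms \<open>finite S\<close> Y _ sets.top])
    moreover have "{\<omega> \<in> space \<Omega>. (\<forall>k\<le>n. Y k \<omega> = x k) \<and> \<omega> \<in> space \<Omega>}
        = {\<omega> \<in> space \<Omega>. \<forall>k\<le>n. Y k \<omega> = x k}" for x
      by auto
    ultimately show ?thesis
      by simp
  qed
  also have "\<dots> = expectation (\<lambda>\<omega>. f (\<lambda>k. Y k \<omega>) * (\<Sum>j\<in>S. P (Y n \<omega>) j * g j))"
    by (rule Bochner_Integration.integral_cong) auto
  finally show ?thesis .
qed

section \<open>Exponential moments of the additive functional\<close>

text \<open>At time \<open>Suc n\<close> the exponential weight involves only the states up to time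
  \<open>n\<close>, so the next state can be averaged out. The last factor
  \<open>exp (\<theta> (Y n \<omega>))\<close> of the weight is what \<open>harm\<close> needs to
  turn that average into \<open>r * v (Y n \<omega>)\<close>.\<close>

lemma exp_sum_harmonic_expectation:
  assumes mc: "markov_chain S P \<mu> \<Omega> Y" and "finite S"
    and harm: "\<And>i. i \<in> S \<Longrightarrow> exp (\<theta> i) * (\<Sum>j\<in>S. P i j * v j) = r * v i"
  shows "prob_space.expectation \<Omega> (\<lambda>\<omega>. exp (\<Sum>k<n. \<theta> (Y k \<omega>)) * v (Y n \<omega>))
    = r ^ n * prob_space.expectation \<Omega> (\<lambda>\<omega>. v (Y 0 \<omega>))"
proof (induction n)
  case (Suc n)
  have Y: "Y k \<in> measurable \<Omega> (count_space S)" for k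
    using mc by (simp add: markov_chain_def)
  have "prob_space.expectation \<Omega> (\<lambda>\<omega>. exp (\<Sum>k<Suc n. \<theta> (Y k \<omega>)) * v (Y (Suc n) \<omega>))
    = prob_space.expectation \<Omega> (\<lambda>\<omega>. exp (\<Sum>k<Suc n. \<theta> (Y k \<omega>)) * (\<Sum>j\<in>S. P (Y n \<omega>) j * v j))"
    using markov_chain_expectation_step[OF mc \<open>finite S\<close>, of n "\<lambda>x. exp (\<Sum>k<Suc n. \<theta> (x k))" v]
    by (simp cong: sum.cong_simp)
  also have "\<dots> = prob_space.expectation \<Omega> (\<lambda>\<omega>. r * (exp (\<Sum>k<n. \<theta> (Y k \<omega>)) * v (Y n \<omega>)))"
  proof (rule Bochner_Integration.integral_cong[OF refl])
    fix \<omega> assume "\<omega> \<in> space \<Omega>"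
    then have "exp (\<theta> (Y n \<omega>)) * (\<Sum>j\<in>S. P (Y n \<omega>) j * v j) = r * v (Y n \<omega>)"
      using measurable_space[OF Y] by (intro harm) auto
    then show "exp (\<Sum>k<Suc n. \<theta> (Y k \<omega>)) * (\<Sum>j\<in>S. P (Y n \<omega>) j * v j)
        = r * (exp (\<Sum>k<n. \<theta> (Y k \<omega>)) * v (Y n \<omega>))"
      by (simp add: exp_add mult.assoc mult.left_commute)
  qed
  also have "\<dots> = r ^ Suc n * prob_space.expectation \<Omega> (\<lambda>\<omega>. v (Y 0 \<omega>))"
    using Suc by simp
  finally show ?case .
qed simp

text \<open>The values of \<open>v\<close> at times \<open>n\<close> and 0 are replaced by the
  constants \<open>a\<close> and \<open>b\<close>, in opposite directions on the two sides of the
  harmonic identity; hence the ratios of the two. The initial law enters only through the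
  expectation of \<open>v (Y 0 \<omega>)\<close>, which lies between \<open>a\<close> and
  \<open>b\<close> in every case.\<close>

lemma exp_sum_expectation_bounds:
  assumes mc: "markov_chain S P \<mu> \<Omega> Y" and "finite S"
    and harm: "\<And>i. i \<in> S \<Longrightarrow> exp (\<theta> i) * (\<Sum>j\<in>S. P i j * v j) = r * v i"
    and "0 \<le> r" and "0 < a" and "0 < b"
    and v: "\<And>i. i \<in> S \<Longrightarrow> a \<le> v i" "\<And>i. i \<in> S \<Longrightarrow> v i \<le> b"
  shows "a / b * r ^ n \<le> prob_space.expectation \<Omega> (\<lambda>\<omega>. exp (\<Sum>k<n. \<theta> (Y k \<omega>)))"
    and "prob_space.expectation \<Omega> (\<lambda>\<omega>. exp (\<Sum>k<n. \<theta> (Y k \<omega>))) \<le> b / a * r ^ n"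
proof -
  interpret prob_space \<Omega>
    using mc by (simp add: markov_chain_def)
  have Y: "Y k \<in> measurable \<Omega> (count_space S)" for k
    using mc by (simp add: markov_chain_def)
  have YS: "Y k \<omega> \<in> S" if "\<omega> \<in> space \<Omega>" for k \<omega>
    using that measurable_space[OF Y] by auto
  note integrable = integrable_history[OF prob_space_axioms \<open>finite S\<close> Y]
  have int_v: "integrable \<Omega> (\<lambda>\<omega>. v (Y 0 \<omega>))"
    using integrable[of 0 "\<lambda>x. v (x 0)"] by simp
  have int_e: "integrable \<Omega> (\<lambda>\<omega>. exp (\<Sum>k<n. \<theta> (Y k \<omega>)))"
    using integrable[of n "\<lambda>x. exp (\<Sum>k<n. \<theta> (x k))"] by (simp cong: sum.cong_simp)
  have int_ev: "integrable \<Omega> (\<lambda>\<omega>. exp (\<Sum>k<n. \<theta> (Y k \<omega>)) * v (Y n \<omega>))"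
    using integrable[of n "\<lambda>x. exp (\<Sum>k<n. \<theta> (x k)) * v (x n)"] by (simp cong: sum.cong_simp)
  let ?E = "expectation (\<lambda>\<omega>. exp (\<Sum>k<n. \<theta> (Y k \<omega>)))"
  let ?V = "expectation (\<lambda>\<omega>. v (Y 0 \<omega>))"
  have harmonic: "expectation (\<lambda>\<omega>. exp (\<Sum>k<n. \<theta> (Y k \<omega>)) * v (Y n \<omega>)) = r ^ n * ?V"
    using mc \<open>finite S\<close> harm by (rule exp_sum_harmonic_expectation)
  have "a \<le> ?V" "?V \<le> b"
    using v YS int_v by (auto intro!: integral_ge_const integral_le_const)
  have "expectation (\<lambda>\<omega>. exp (\<Sum>k<n. \<theta> (Y k \<omega>)) * a) \<le> r ^ n * ?V"
    unfolding harmonic[symmetric] using int_e int_ev v YS by (intro integral_mono) auto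
  also have "\<dots> \<le> r ^ n * b"
    using \<open>?V \<le> b\<close> \<open>0 \<le> r\<close> by (simp add: mult_left_mono)
  finally show "?E \<le> b / a * r ^ n"
    using \<open>0 < a\<close> by (simp add: field_simps)
  have "r ^ n * a \<le> r ^ n * ?V"
    using \<open>a \<le> ?V\<close> \<open>0 \<le> r\<close> by (simp add: mult_left_mono)
  also have "\<dots> \<le> expectation (\<lambda>\<omega>. exp (\<Sum>k<n. \<theta> (Y k \<omega>)) * b)"
    unfolding harmonic[symmetric] using int_e int_ev v YS by (intro integral_mono) auto
  finally show "a / b * r ^ n \<le> ?E"
    using \<open>0 < b\<close> by (simp add: field_simps)
qed

theorem lemma2p3:
  fixes M :: nat
    and P :: "nat \<Rightarrow> nat \<Rightarrow> real"
    and \<theta> :: "nat \<Rightarrow> real"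
    and lam1 :: real
  assumes "1 < M"
    and "stochastic_on {1..M} P"
    and "\<And>i j. i \<in> {1..M} \<Longrightarrow> j \<in> {1..M} \<Longrightarrow> 0 < P i j"
    and "lam1 = Max (Re ` spectrum (tilted_matrix M \<theta> P))"
  shows "\<exists>K\<^sub>3 K\<^sub>4 :: real. 0 < K\<^sub>3 \<and> 0 < K\<^sub>4 \<and>
    (\<forall>\<mu> (\<Omega> :: 'a measure) Y. set_pmf \<mu> \<subseteq> {1..M} \<longrightarrow> markov_chain {1..M} P \<mu> \<Omega> Y \<longrightarrow>
      (\<forall>\<^sub>F n in sequentially.
         K\<^sub>3 * lam1 ^ n \<le> prob_space.expectation \<Omega> (\<lambda>\<omega>. exp (\<Sum>k<n. \<theta> (Y k \<omega>))) \<and>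
         prob_space.expectation \<Omega> (\<lambda>\<omega>. exp (\<Sum>k<n. \<theta> (Y k \<omega>))) \<le> K\<^sub>4 * lam1 ^ n))"
proof -
  obtain v where v: "\<And>i. i \<in> {1..M} \<Longrightarrow> 0 < v i"
    "\<And>i. i \<in> {1..M} \<Longrightarrow> exp (\<theta> i) * (\<Sum>j\<in>{1..M}. P i j * v j) = lam1 * v i"
    and "0 < lam1"
    using tilted_matrix_perron[of M P \<theta>] assms by auto
  \<comment> \<open>Both constants come from \<open>v\<close> alone, so they are fixed before the
    initial law, the probability space and the chain are chosen.\<close>
  define a where "a = Min (v ` {1..M})"
  define b where "b = Max (v ` {1..M})"
  have "a \<in> v ` {1..M}" "b \<in> v ` {1..M}"
    unfolding a_def b_def using assms(1) by (auto intro!: Min_in Max_in)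
  then have "0 < a" "0 < b"
    using v(1) by auto
  have ab: "a \<le> v i" "v i \<le> b" if "i \<in> {1..M}" for i
    using that by (auto simp: a_def b_def)
  show ?thesis
  proof (rule exI[of _ "a / b"], rule exI[of _ "b / a"], intro conjI allI impI always_eventually)
    fix \<mu> n and \<Omega> :: "'a measure" and Y
    assume mc: "markov_chain {1..M} P \<mu> \<Omega> Y"
    note bounds = exp_sum_expectation_bounds[OF mc finite_atLeastAtMost v(2)
        less_imp_le[OF \<open>0 < lam1\<close>] \<open>0 < a\<close> \<open>0 < b\<close> ab]
    show "a / b * lam1 ^ n \<le> prob_space.expectation \<Omega> (\<lambda>\<omega>. exp (\<Sum>k<n. \<theta> (Y k \<omega>)))"
      by (rule bounds(1))
    show "prob_space.expectation \<Omega> (\<lambda>\<omega>. exp (\<Sum>k<n. \<theta> (Y k \<omega>))) \<le> b / a * lam1 ^ n"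
      by (rule bounds(2))
  qed (use \<open>0 < a\<close> \<open>0 < b\<close> in auto)
qed

end
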